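(* Let $R>0$, $Cu>0$, $b>0$, $\alpha>0$, $n<0$, $c\in(0,1)$, and suppose $$\left(1-\frac{\alpha+1}{n}\right)^{\frac{n-1-\alpha}{\alpha}}=\frac{1-c}{\alpha c}.$$ Consider the boundary value problem $$\frac{1}{Y}\frac{d}{dY}\left\{\left[1-c+c\left(1+Cu^\alpha |U_Y|^\alpha\right)^{\frac{n-1}{\alpha}}\right]Y\,U_Y\right\}=b \quad\text{for } Y\in(0,R),\qquad U_Y(0)=U(R)=0. \tag{P}$$ (1) If $$\left[1-c+c\left(1-\frac{\alpha+1}{n}\right)^{\frac{n-1}{\alpha}}\right]Cu^{-1}\left(-\frac{\alpha+1}{n}\right)^{\frac1\alpha}\ge\frac{bR}{2},$$ then (P) has a unique classical solution $U$, and it satisfies $$U(Y)=-\int_Y^R F^{-1}\left(\frac{bs}{2}\right)ds\quad\text{and}\quad 0\le U_Y(Y)\le F^{-1}\left(\frac{bR}{2}\right)\quad\text{for } Y\in[0,R]. \tag{S}$$ (2) If $$\left[1-c+c\left(1-\frac{\alpha+1}{n}\right)^{\frac{n-1}{\alpha}}\right]Cu^{-1}\left(-\frac{\alpha+1}{n}\right)^{\frac1\alpha}<\frac{bR}{2},$$ then (P) has a unique generalized solution $U\in C^2([0,R]\setminus\{Y_0\})\cap C^1([0,R])$, and it satisfies (S) and $U_{YY}(Y_0)=\infty$, where $$Y_0=\frac{2}{b}\left[1-c+c\left(1-\frac{\alpha+1}{n}\right)^{\frac{n-1}{\alpha}}\right]Cu^{-1}\left(-\frac{\alpha+1}{n}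\right)^{\frac1\alpha}\in(0,R).$$
   Context: $U=U(Y)$ is a real-valued function on $[0,R]$, $U_Y=dU/dY$, $U_{YY}=d^2U/dY^2$. $Cu$ is a single symbol (a real number, the Carreau number) and $Cu^\alpha$ denotes its $\alpha$-th power. A classical solution is a function $U\in C^2((0,R))\cap C^1([0,R])$ satisfying the equation pointwise in $(0,R)$ and the boundary conditions $U_Y(0)=U(R)=0$. A generalized solution in part (2) is a function $U\in C^2([0,R]\setminus\{Y_0\})\cap C^1([0,R])$ satisfying the equation pointwise in $(0,R)\setminus\{Y_0\}$ and the boundary conditions. The notation $U_{YY}(Y_0)=\infty$ means $U_{YY}(Y)\to+\infty$ as $Y\to Y_0$. The function $F:[0,\infty)\to\mathbb{R}$ is $$F(\zeta)=\left[1-c+c\left(1+Cu^\alpha\zeta^\alpha\right)^{\frac{n-1}{\alpha}}\right]\zeta,\qquad \zeta\ge0,$$ and $F^{-1}:[0,\infty)\to[0,\infty)$ denotes its inverse function. *)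

theory Defs
  imports "HOL-Analysis.Analysis"
begin

text \<open>At an end point contained in \<open>S\<close>, this is the one-sided derivative. For \<open>x\<close> in \<open>S\<close> it
  depends only on the values of \<open>f\<close> on \<open>S\<close>.\<close>

definition deriv_on :: "real set \<Rightarrow> (real \<Rightarrow> real) \<Rightarrow> real \<Rightarrow> real" where
  "deriv_on S f x = vector_derivative f (at x within S)"

text \<open>The class \<open>C\<^sup>k(S)\<close>, meant for sets \<open>S\<close> without isolated points.\<close>

primrec Ck_on :: "nat \<Rightarrow> real set \<Rightarrow> (real \<Rightarrow> real) \<Rightarrow> bool" where
  "Ck_on 0 S f \<longleftrightarrow> continuous_on S f"
| "Ck_on (Suc k) S f \<longleftrightarrow> (\<forall>x\<in>S. f differentiable (at x within S)) \<and> Ck_on k S (deriv_on S f)"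

definition viscosity :: "real \<Rightarrow> real \<Rightarrow> real \<Rightarrow> real \<Rightarrow> real \<Rightarrow> real" where
  "viscosity c Cu \<alpha> n \<zeta> = 1 - c + c * (1 + Cu powr \<alpha> * \<zeta> powr \<alpha>) powr ((n - 1) / \<alpha>)"

definition F :: "real \<Rightarrow> real \<Rightarrow> real \<Rightarrow> real \<Rightarrow> real \<Rightarrow> real" where
  "F c Cu \<alpha> n \<zeta> = viscosity c Cu \<alpha> n \<zeta> * \<zeta>"

definition F_inv :: "real \<Rightarrow> real \<Rightarrow> real \<Rightarrow> real \<Rightarrow> real \<Rightarrow> real" where
  "F_inv c Cu \<alpha> n = inv_into {0..} (F c Cu \<alpha> n)"

text \<open>The differential equation at a point \<open>Y\<close> of \<open>(0,R)\<close>; the existence of the outer derivative is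
  part of the condition.\<close>

definition equation_at ::
    "real \<Rightarrow> real \<Rightarrow> real \<Rightarrow> real \<Rightarrow> real \<Rightarrow> real \<Rightarrow> (real \<Rightarrow> real) \<Rightarrow> real \<Rightarrow> bool" where
  "equation_at R b c Cu \<alpha> n U Y \<longleftrightarrow>
     (\<exists>D. ((\<lambda>y. viscosity c Cu \<alpha> n \<bar>deriv_on {0..R} U y\<bar> * y * deriv_on {0..R} U y)
             has_real_derivative D) (at Y)
          \<and> 1 / Y * D = b)"

definition classical_solution ::
    "real \<Rightarrow> real \<Rightarrow> real \<Rightarrow> real \<Rightarrow> real \<Rightarrow> real \<Rightarrow> (real \<Rightarrow> real) \<Rightarrow> bool" where
  "classical_solution R b c Cu \<alpha> n U \<longleftrightarrow>
     Ck_on 2 {0<..<R} U \<and> Ck_on 1 {0..R} U \<and>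
     (\<forall>Y\<in>{0<..<R}. equation_at R b c Cu \<alpha> n U Y) \<and>
     deriv_on {0..R} U 0 = 0 \<and> U R = 0"

definition generalized_solution ::
    "real \<Rightarrow> real \<Rightarrow> real \<Rightarrow> real \<Rightarrow> real \<Rightarrow> real \<Rightarrow> real \<Rightarrow> (real \<Rightarrow> real) \<Rightarrow> bool" where
  "generalized_solution R b c Cu \<alpha> n Y\<^sub>0 U \<longleftrightarrow>
     Ck_on 2 ({0..R} - {Y\<^sub>0}) U \<and> Ck_on 1 {0..R} U \<and>
     (\<forall>Y\<in>{0<..<R} - {Y\<^sub>0}. equation_at R b c Cu \<alpha> n U Y) \<and>
     deriv_on {0..R} U 0 = 0 \<and> U R = 0"

definition solution_formula ::
    "real \<Rightarrow> real \<Rightarrow> real \<Rightarrow> real \<Rightarrow> real \<Rightarrow> real \<Rightarrow> (real \<Rightarrow> real) \<Rightarrow> bool" where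
  "solution_formula R b c Cu \<alpha> n U \<longleftrightarrow>
     (\<forall>Y\<in>{0..R}.
        (\<lambda>s. F_inv c Cu \<alpha> n (b * s / 2)) integrable_on {Y..R} \<and>
        U Y = - integral {Y..R} (\<lambda>s. F_inv c Cu \<alpha> n (b * s / 2)) \<and>
        0 \<le> deriv_on {0..R} U Y \<and> deriv_on {0..R} U Y \<le> F_inv c Cu \<alpha> n (b * R / 2))"

end

theory Submission
  imports Defs
begin

text \<open>One integration turns the boundary value problem into an algebraic equation for the slope, and
  the hypothesis on the parameters says that this equation is monotone with exactly one
  degenerate point.

  \<^bold>\<open>Reduction.\<close> The equation reads \<open>(Y \<Phi>(U\<^sub>Y))' = b Y\<close>, where \<open>\<Phi>(z)\<close> is the odd function
  \<open>viscosity \<bar>z\<bar> * z\<close>, called \<open>flux\<close> below; it extends \<open>F\<close> from \<open>[0,\<infinity>)\<close> to the whole line. Since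
  \<open>Y \<Phi>(U\<^sub>Y)\<close> is continuous and vanishes at \<open>0\<close>, integration gives \<open>\<Phi>(U\<^sub>Y(Y)) = b Y / 2\<close> on \<open>[0,R]\<close>, and one
  exceptional interior point does no harm, because a continuous function whose derivative
  vanishes off a finite set is constant (\<open>flux_of_solution\<close>). If \<open>\<Phi>\<close> has an inverse, called
  \<open>slope\<close> below, then \<open>U\<^sub>Y(Y) = slope (b Y / 2)\<close>, so that \<open>U(R) = 0\<close> leaves only the function in the
  solution formula (\<open>solution_unique\<close>). Working with the odd extension removes the absolute
  value from the equation, excludes negative slopes without a separate argument, and makes
  \<open>0\<close> an interior point where two-sided derivatives are available.

  \<^bold>\<open>Monotonicity.\<close> With \<open>x = (Cu \<bar>z\<bar>)\<^sup>\<alpha>\<close> one computes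
  \<open>\<Phi>'(z) = 1 - c + c (1 + x) powr ((n - 1 - \<alpha>) / \<alpha>) (1 + n x)\<close>. The \<open>x\<close>-dependent factor decreases up to
  \<open>x = -(\<alpha> + 1) / n\<close> and increases afterwards, and the hypothesis says precisely that its minimum
  is \<open>-(1 - c) / c\<close> (\<open>marginal_min\<close>, \<open>marginal_x_crit\<close>). Hence \<open>\<Phi>' \<ge> 0\<close> with zeros only at \<open>\<plusminus>zeta_crit\<close>
  (\<open>flux'_zero_iff\<close>). Therefore \<open>\<Phi>\<close> is a strictly increasing homeomorphism of the line, and its
  inverse is continuously differentiable away from \<open>\<plusminus>\<Phi>(zeta_crit)\<close>.

  \<^bold>\<open>Regularity.\<close> The second derivative of the solution is \<open>(b / 2) / \<Phi>'(slope (b Y / 2))\<close>, which is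
  continuous except where \<open>b Y / 2 = \<Phi>(zeta_crit)\<close>, that is, at \<open>Y = Y_crit\<close>. This point lies in
  \<open>(0,R)\<close> exactly when \<open>\<Phi>(zeta_crit) < b R / 2\<close>, which separates the two cases; there the denominator
  tends to \<open>0\<close> through positive values, so the second derivative tends to infinity
  (\<open>second_derivative_blow_up\<close>).\<close>

section \<open>Real functions on intervals\<close>

text \<open>A function with nonnegative derivative that is not strictly increasing is constant on some
  interval, and that interval then consists of zeros of the derivative.\<close>

lemma strict_mono_if_deriv_nonneg_finite_zeros:
  fixes f f' :: "real \<Rightarrow> real"
  assumes der: "\<And>x. (f has_real_derivative f' x) (at x)"
    and nonneg: "\<And>x. 0 \<le> f' x" and fin: "finite {x. f' x = 0}"
  shows "strict_mono f"
proof (rule strict_monoI)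
  fix a b :: real
  assume "a < b"
  have mono: "f x \<le> f y" if "x \<le> y" for x y
    by (rule DERIV_nonneg_imp_nondecreasing[OF that]) (use der nonneg in blast)
  show "f a < f b"
  proof (rule ccontr)
    assume "\<not> f a < f b"
    then have "f x = f a" if "x \<in> {a<..<b}" for x
      using mono[of a x] mono[of x b] that by force
    then have "(f has_real_derivative 0) (at x)" if "x \<in> {a<..<b}" for x
      using that
      by (intro has_field_derivative_transform_within_open[of "\<lambda>_. f a" 0 x "{a<..<b}" f]) auto
    then have "{a<..<b} \<subseteq> {x. f' x = 0}"
      using der DERIV_unique by blast
    then show False
      using fin \<open>a < b\<close> infinite_Ioo[of a b] finite_subset by blast
  qed
qed

lemma deriv_on_eqI:
  assumes "at x within S \<noteq> bot" "(f has_real_derivative D) (at x within S)"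
  shows "deriv_on S f x = D"
  unfolding deriv_on_def
  using assms by (simp add: vector_derivative_within has_real_derivative_iff_has_vector_derivative)

lemma Ck_on_1D:
  assumes "Ck_on 1 S f" "x \<in> S"
  shows "(f has_real_derivative deriv_on S f x) (at x within S)"
  using assms unfolding deriv_on_def
  by (simp add: vector_derivative_works has_real_derivative_iff_has_vector_derivative)

lemma Ck_on_1_continuous:
  assumes "Ck_on 1 S f"
  shows "continuous_on S (deriv_on S f)"
  using assms by simp

text \<open>Since \<open>deriv_on\<close> takes arbitrary values at isolated points, \<open>S\<close> must have none; then the one-sided
  or two-sided derivatives on \<open>S\<close> are unique and can be replaced by the given functions.\<close>

lemma Ck_on_2I:
  assumes perfect: "\<And>x. x \<in> S \<Longrightarrow> at x within S \<noteq> bot"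
    and f: "\<And>x. x \<in> S \<Longrightarrow> (f has_real_derivative f' x) (at x within S)"
    and f': "\<And>x. x \<in> S \<Longrightarrow> (f' has_real_derivative f'' x) (at x within S)"
    and f'': "continuous_on S f''"
  shows "Ck_on 2 S f" "\<And>x. x \<in> S \<Longrightarrow> deriv_on S (deriv_on S f) x = f'' x"
proof -
  have 1: "deriv_on S f x = f' x" if "x \<in> S" for x
    using deriv_on_eqI perfect f that by blast
  have 2: "(deriv_on S f has_real_derivative f'' x) (at x within S)" if "x \<in> S" for x
    using f'[OF that] zero_less_one that
    by (rule has_field_derivative_transform_within) (simp add: 1)
  show 3: "deriv_on S (deriv_on S f) x = f'' x" if "x \<in> S" for x
    using deriv_on_eqI perfect 2 that by blast
  have "continuous_on S (deriv_on S (deriv_on S f))"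
    using f'' 3 by (simp cong: continuous_on_cong)
  then show "Ck_on 2 S f"
    using f 2 by (auto simp: numeral_2_eq_2 real_differentiable_def)
qed

lemma at_within_Icc_minus_point:
  fixes x R :: real
  assumes "0 < R" "x \<in> {0..R}" "x \<noteq> p"
  shows "at x within ({0..R} - {p}) = at x within {0..R}" "at x within {0..R} \<noteq> bot"
proof -
  show "at x within ({0..R} - {p}) = at x within {0..R}"
    using assms by (intro at_within_nhd[of x "- {p}"]) auto
  show "at x within {0..R} \<noteq> bot"
    using assms by (simp add: trivial_limit_within islimpt_Icc)
qed

section \<open>The constitutive law\<close>

locale carreau =
  fixes c Cu \<alpha> n :: real
  assumes Cu: "Cu > 0" and alpha: "\<alpha> > 0" and n: "n < 0" and c: "0 < c" "c < 1"
    and critical: "(1 - (\<alpha> + 1) / n) powr ((n - 1 - \<alpha>) / \<alpha>) = (1 - c) / (\<alpha> * c)"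
begin

abbreviation "visc \<equiv> viscosity c Cu \<alpha> n"

text \<open>The part of the derivative of \<open>flux\<close> that comes from the power law, as a function of
  \<open>x = (Cu \<bar>z\<bar>)\<^sup>\<alpha>\<close>.\<close>

definition marginal :: "real \<Rightarrow> real" where
  "marginal x = (1 + x) powr ((n - 1 - \<alpha>) / \<alpha>) * (1 + n * x)"

definition x_crit :: real where "x_crit = - (\<alpha> + 1) / n"

definition zeta_crit :: real where "zeta_crit = inverse Cu * x_crit powr (1 / \<alpha>)"

definition scaled_shear :: "real \<Rightarrow> real" where
  "scaled_shear z = Cu powr \<alpha> * \<bar>z\<bar> powr \<alpha>"

text \<open>The absolute value makes this an odd function on the whole line which agrees with \<open>F\<close> on
  the half-line.\<close>

definition flux :: "real \<Rightarrow> real" where "flux z = visc \<bar>z\<bar> * z"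

definition flux' :: "real \<Rightarrow> real" where
  "flux' z = 1 - c + c * marginal (scaled_shear z)"

lemma x_crit_pos: "0 < x_crit"
  using alpha n by (simp add: x_crit_def divide_neg_neg)

lemma zeta_crit_pos: "0 < zeta_crit"
  using x_crit_pos Cu by (simp add: zeta_crit_def)

lemma scaled_shear_nonneg: "0 \<le> scaled_shear z"
  by (simp add: scaled_shear_def)

lemma scaled_shear_zeta_crit: "scaled_shear zeta_crit = x_crit"
proof -
  have "scaled_shear zeta_crit = (Cu * inverse Cu) powr \<alpha> * (x_crit powr (1 / \<alpha>)) powr \<alpha>"
    using Cu zeta_crit_pos x_crit_pos
    by (simp add: scaled_shear_def zeta_crit_def powr_mult[symmetric] mult.assoc[symmetric])
  then show ?thesis
    using Cu alpha x_crit_pos by (simp add: powr_powr)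
qed

lemma scaled_shear_eq_x_crit_iff: "scaled_shear z = x_crit \<longleftrightarrow> \<bar>z\<bar> = zeta_crit"
proof -
  have "scaled_shear z = scaled_shear zeta_crit \<longleftrightarrow> \<bar>z\<bar> powr \<alpha> = zeta_crit powr \<alpha>"
    using Cu zeta_crit_pos by (simp add: scaled_shear_def)
  also have "\<dots> \<longleftrightarrow> \<bar>z\<bar> = zeta_crit"
    using alpha zeta_crit_pos by (metis abs_ge_zero order_less_imp_le powr_less_mono2 less_linear order_less_irrefl)
  finally show ?thesis by (simp add: scaled_shear_zeta_crit)
qed

lemma scaled_shear_continuous: "continuous_on S scaled_shear"
  unfolding scaled_shear_def using alpha by (intro continuous_intros continuous_on_powr') auto

text \<open>Collecting the common power of \<open>1 + x\<close> leaves a linear factor, so the sign of the derivative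
  changes exactly once.\<close>

lemma marginal_deriv:
  assumes "-1 < x"
  shows "(marginal has_real_derivative
            (1 + x) powr ((n - 1 - \<alpha>) / \<alpha> - 1) * ((n - 1) * n / \<alpha>) * (x - x_crit)) (at x)"
proof -
  define q where "q = (n - 1 - \<alpha>) / \<alpha>"
  have eq: "q * (1 + n * x) + (1 + x) * n = ((n - 1) * n / \<alpha>) * (x - x_crit)"
    using alpha n by (simp add: q_def x_crit_def field_simps)
  have "(marginal has_real_derivative
      (q * (1 + x) powr (q - 1)) * (1 + n * x) + (1 + x) powr q * n) (at x)"
    unfolding marginal_def q_def[symmetric] using assms
    by (auto intro!: derivative_eq_intros simp: powr_diff)
  moreover have "(1 + x) powr q = (1 + x) powr (q - 1) * (1 + x)"
    using assms by (simp add: powr_diff)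
  ultimately have "(marginal has_real_derivative
      (1 + x) powr (q - 1) * (q * (1 + n * x) + (1 + x) * n)) (at x)"
    by (elim DERIV_cong) (simp add: algebra_simps)
  then show ?thesis
    unfolding q_def[symmetric] eq by (simp only: mult.assoc)
qed

lemma one_plus_x_crit: "1 + x_crit = 1 - (\<alpha> + 1) / n"
  by (simp add: x_crit_def diff_divide_distrib add_divide_distrib)

text \<open>This is where the hypothesis on the parameters enters: at \<open>x_crit\<close> the linear factor
  \<open>1 + n x\<close> equals \<open>-\<alpha>\<close>, and the hypothesis gives the value of the power.\<close>

lemma marginal_x_crit: "marginal x_crit = - ((1 - c) / c)"
proof -
  have "1 + n * x_crit = - \<alpha>"
    using n by (simp add: x_crit_def)
  then show ?thesis
    using critical alpha c by (simp add: marginal_def one_plus_x_crit)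
qed

text \<open>The derivative is a positive multiple of \<open>x - x_crit\<close>, because \<open>n\<close> and \<open>n - 1\<close> are both
  negative.\<close>

lemma marginal_min:
  assumes "0 \<le> x" "x \<noteq> x_crit"
  shows "marginal x_crit < marginal x"
proof -
  \<comment> \<open>the positive factor of the derivative\<close>
  define A where "A = (\<lambda>y. (1 + y) powr ((n - 1 - \<alpha>) / \<alpha> - 1) * ((n - 1) * n / \<alpha>))"
  have A: "0 < A y" if "0 \<le> y" for y
    using that n alpha by (simp add: A_def mult_neg_neg)
  have der: "(marginal has_real_derivative A y * (y - x_crit)) (at y)" if "0 \<le> y" for y
    using marginal_deriv[of y] that by (simp add: A_def)
  have cont: "continuous_on {a..b} marginal" if "0 \<le> a" for a b
    using that der by (intro DERIV_continuous_on[where D="\<lambda>y. A y * (y - x_crit)"])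
      (auto intro: has_field_derivative_at_within)
  show ?thesis
  proof (cases "x < x_crit")
    case True
    show ?thesis
    proof (rule DERIV_neg_imp_decreasing_open[OF True])
      fix y assume "x < y" "y < x_crit"
      with assms der[of y] A[of y] show "\<exists>D. (marginal has_real_derivative D) (at y) \<and> D < 0"
        by (intro exI[of _ "A y * (y - x_crit)"]) (auto simp: mult_less_0_iff)
    qed (use cont assms in auto)
  next
    case False
    with assms have "x_crit < x" by simp
    then show ?thesis
    proof (rule DERIV_pos_imp_increasing_open)
      fix y assume "x_crit < y" "y < x"
      with x_crit_pos der[of y] A[of y] show "\<exists>D. (marginal has_real_derivative D) (at y) \<and> D > 0"
        by (intro exI[of _ "A y * (y - x_crit)"]) (auto simp: zero_less_mult_iff)
    qed (use cont x_crit_pos in auto)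
  qed
qed

text \<open>The minimum of \<open>marginal\<close> is strict and is exactly what cancels \<open>1 - c\<close>; away from it the
  derivative is positive.\<close>

lemma flux'_zero_iff: "flux' z = 0 \<longleftrightarrow> \<bar>z\<bar> = zeta_crit"
  and flux'_nonneg: "0 \<le> flux' z"
proof -
  have crit: "1 - c + c * marginal x_crit = 0"
    using c by (simp add: marginal_x_crit)
  have "0 < flux' z" if "scaled_shear z \<noteq> x_crit"
    using mult_strict_left_mono[OF marginal_min[OF scaled_shear_nonneg that] c(1)] crit
    by (simp add: flux'_def)
  then show "flux' z = 0 \<longleftrightarrow> \<bar>z\<bar> = zeta_crit" "0 \<le> flux' z"
    using crit unfolding scaled_shear_eq_x_crit_iff[symmetric] by (fastforce simp: flux'_def)+
qed

lemma flux'_continuous: "continuous_on S flux'"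
  unfolding flux'_def marginal_def
  by (intro continuous_intros continuous_on_powr' scaled_shear_continuous)
     (use scaled_shear_nonneg in \<open>auto simp: add_nonneg_eq_0_iff\<close>)

lemma visc_continuous: "continuous_on S (\<lambda>z. visc \<bar>z\<bar>)"
  unfolding viscosity_def scaled_shear_def[symmetric]
  by (intro continuous_intros continuous_on_powr' scaled_shear_continuous)
     (use scaled_shear_nonneg in \<open>auto simp: add_nonneg_eq_0_iff\<close>)

text \<open>The Newtonian part \<open>1 - c\<close> of the viscosity keeps the flux unbounded, hence onto.\<close>

lemma visc_ge: "1 - c \<le> visc z"
  using c by (simp add: viscosity_def)

lemma flux_minus: "flux (- z) = - flux z"
  by (simp add: flux_def)

lemma flux_0 [simp]: "flux 0 = 0"
  by (simp add: flux_def)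

lemma flux_eq_F: "0 \<le> z \<Longrightarrow> F c Cu \<alpha> n z = flux z"
  by (simp add: F_def flux_def)

text \<open>Away from the origin the chain rule applies. The term from differentiating the viscosity is
  \<open>c (n - 1) x (1 + x) powr ((n - 1) / \<alpha> - 1)\<close>, which combines with \<open>c (1 + x) powr ((n - 1) / \<alpha>)\<close> into
  \<open>c * marginal x\<close>.\<close>

lemma flux_deriv_pos:
  assumes "0 < z"
  shows "(flux has_real_derivative flux' z) (at z)"
proof -
  define q where "q = (n - 1) / \<alpha>"
  have s: "(scaled_shear has_real_derivative \<alpha> * scaled_shear z / z) (at z)"
  proof (rule has_field_derivative_transform_within_open)
    show "((\<lambda>z. Cu powr \<alpha> * z powr \<alpha>) has_real_derivative \<alpha> * scaled_shear z / z) (at z)"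
      using assms by (auto intro!: derivative_eq_intros simp: scaled_shear_def powr_diff)
  qed (use assms in \<open>auto simp: scaled_shear_def intro: open_greaterThan\<close>)
  have 1: "0 < 1 + scaled_shear z"
    using scaled_shear_nonneg[of z] by simp
  have "(flux has_real_derivative
     c * (q * (1 + scaled_shear z) powr (q - 1) * (\<alpha> * scaled_shear z / z)) * z
     + (1 - c + c * (1 + scaled_shear z) powr q)) (at z)"
    unfolding flux_def viscosity_def scaled_shear_def[symmetric] q_def[symmetric] using 1 assms
    by (auto intro!: derivative_eq_intros s simp: powr_diff)
  moreover have "(1 + scaled_shear z) powr q = (1 + scaled_shear z) powr (q - 1) * (1 + scaled_shear z)"
    using 1 by (simp add: powr_diff)
  moreover have "q - 1 = (n - 1 - \<alpha>) / \<alpha>" "q * \<alpha> = n - 1"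
    using alpha by (simp_all add: q_def field_simps)
  ultimately show ?thesis
    using assms unfolding flux'_def marginal_def
    by (elim DERIV_cong) (simp add: algebra_simps, algebra)
qed

text \<open>For negative arguments oddness reduces the claim to positive ones. At \<open>0\<close> the chain rule fails
  for \<open>\<alpha> \<le> 1\<close>, since \<open>\<bar>z\<bar>\<^sup>\<alpha>\<close> is not differentiable there, but the difference quotient of the flux is
  the viscosity itself, which is continuous.\<close>

lemma flux_deriv: "(flux has_real_derivative flux' z) (at z)"
proof -
  consider "0 < z" | "z < 0" | "z = 0" by linarith
  then show ?thesis
  proof cases
    case 2
    have "((\<lambda>y. - flux (- y)) has_real_derivative flux' (- z)) (at z)"
      using flux_deriv_pos[of "- z"] 2
      by (auto intro!: derivative_eq_intros DERIV_chain'[of uminus _ _ _ flux])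
    then show ?thesis by (simp add: flux_minus flux'_def scaled_shear_def)
  next
    case 3
    have "flux' 0 = visc \<bar>0\<bar>"
      using alpha by (simp add: flux'_def viscosity_def marginal_def scaled_shear_def)
    moreover have "((\<lambda>h. visc \<bar>h\<bar>) \<longlongrightarrow> visc \<bar>0\<bar>) (at 0)"
      using visc_continuous[of UNIV] unfolding continuous_on_def by blast
    ultimately have "((\<lambda>h. visc \<bar>h\<bar>) \<longlongrightarrow> flux' 0) (at 0)" by simp
    then have "((\<lambda>h. (flux (0 + h) - flux 0) / h) \<longlongrightarrow> flux' 0) (at 0)"
      by (rule Lim_transform_eventually) (auto simp: eventually_at_filter flux_def)
    then show ?thesis
      using 3 by (simp add: DERIV_def)
  qed (rule flux_deriv_pos)
qed

lemma flux_isCont: "isCont flux z"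
  using flux_deriv DERIV_isCont by blast

lemma flux_strict_mono: "strict_mono flux"
proof (rule strict_mono_if_deriv_nonneg_finite_zeros[OF flux_deriv flux'_nonneg])
  have "{x. flux' x = 0} \<subseteq> {zeta_crit, - zeta_crit}"
    by (auto simp: flux'_zero_iff)
  then show "finite {x. flux' x = 0}"
    by (rule finite_subset) simp
qed

text \<open>As the flux dominates \<open>(1 - c) z\<close>, the value \<open>y\<close> is passed on the interval from \<open>0\<close> to
  \<open>y / (1 - c)\<close>.\<close>

lemma flux_surj_nonneg:
  assumes "0 \<le> y"
  shows "\<exists>z\<ge>0. flux z = y"
proof -
  have "y \<le> flux (y / (1 - c))"
    using mult_right_mono[OF visc_ge[of "\<bar>y / (1 - c)\<bar>"], of "y / (1 - c)"] assms c
    by (simp add: flux_def)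
  then show ?thesis
    using IVT'[of flux 0 y "y / (1 - c)"] assms c flux_isCont
    by (auto simp: continuous_at_imp_continuous_on)
qed

lemma flux_surj: "surj flux"
proof (rule surjI)
  fix y
  show "flux (SOME z. flux z = y) = y"
  proof (rule someI_ex)
    show "\<exists>z. flux z = y"
      using flux_surj_nonneg[of y] flux_surj_nonneg[of "- y"] flux_minus
      by (metis linear neg_0_le_iff_le minus_minus)
  qed
qed

text \<open>The velocity gradient that a given signed shear stress produces.\<close>

definition slope :: "real \<Rightarrow> real" where "slope = inv flux"

lemma flux_slope [simp]: "flux (slope y) = y"
  by (simp add: slope_def flux_surj surj_f_inv_f)

lemma slope_flux [simp]: "slope (flux z) = z"
  by (simp add: slope_def flux_strict_mono strict_mono_imp_inj_on inv_f_f)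

lemma slope_mono: "x \<le> y \<Longrightarrow> slope x \<le> slope y"
  using flux_strict_mono by (metis flux_slope strict_mono_less_eq)

lemma slope_nonneg: "0 \<le> y \<Longrightarrow> 0 \<le> slope y"
  using slope_mono[of 0 y] slope_flux[of 0] by simp

lemma slope_isCont: "isCont slope y"
  using isCont_inverse_function[of 1 "slope y" slope flux] flux_isCont by simp

text \<open>The stress \<open>flux zeta_crit\<close> is the only nonnegative one at which the inverse function theorem
  fails.\<close>

lemma slope_deriv:
  assumes "0 \<le> y" "y \<noteq> flux zeta_crit"
  shows "(slope has_real_derivative inverse (flux' (slope y))) (at y)"
    and "0 < flux' (slope y)"
proof -
  have "\<bar>slope y\<bar> \<noteq> zeta_crit"
    using assms slope_nonneg by (metis abs_of_nonneg flux_slope)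
  then have nz: "flux' (slope y) \<noteq> 0"
    by (simp add: flux'_zero_iff)
  then show "0 < flux' (slope y)"
    using flux'_nonneg less_eq_real_def by metis
  show "(slope has_real_derivative inverse (flux' (slope y))) (at y)"
    by (rule DERIV_inverse_function[where f=flux and a="y - 1" and b="y + 1"])
       (simp_all add: nz flux_deriv slope_isCont)
qed

lemma F_bij: "bij_betw (F c Cu \<alpha> n) {0..} {0..}"
proof (rule bij_betw_imageI)
  show "inj_on (F c Cu \<alpha> n) {0..}"
    using flux_strict_mono by (auto simp: inj_on_def flux_eq_F strict_mono_eq)
  have "flux z \<ge> 0" if "z \<ge> 0" for z
    using flux_strict_mono that by (metis flux_0 strict_mono_less_eq)
  then show "F c Cu \<alpha> n ` {0..} = {0..}"
    using flux_surj_nonneg by (force simp: flux_eq_F image_iff)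
qed

lemma F_inv_eq_slope: "0 \<le> y \<Longrightarrow> F_inv c Cu \<alpha> n y = slope y"
  unfolding F_inv_def
  using F_bij by (intro inv_into_f_eq) (auto simp: bij_betw_def flux_eq_F slope_nonneg)

end

section \<open>The velocity profile in the pipe\<close>

locale carreau_pipe = carreau +
  fixes R b :: real
  assumes R: "R > 0" and b: "b > 0"
begin

definition profile :: "real \<Rightarrow> real" where
  "profile Y = - integral {Y..R} (\<lambda>s. slope (b * s / 2))"

definition Y_crit :: real where "Y_crit = 2 / b * flux zeta_crit"

lemma load_slope_continuous: "continuous_on S (\<lambda>s. slope (b * s / 2))"
  by (rule continuous_on_compose2[of UNIV slope])
     (auto intro!: continuous_intros continuous_at_imp_continuous_on slope_isCont)

lemma load_slope_deriv:
  assumes "0 \<le> Y" "Y \<noteq> Y_crit"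
  shows "((\<lambda>s. slope (b * s / 2)) has_real_derivative b / 2 / flux' (slope (b * Y / 2))) (at Y)"
    and "0 < flux' (slope (b * Y / 2))"
proof -
  have *: "0 \<le> b * Y / 2" "b * Y / 2 \<noteq> flux zeta_crit"
    using assms b by (auto simp: Y_crit_def field_simps)
  show "((\<lambda>s. slope (b * s / 2)) has_real_derivative b / 2 / flux' (slope (b * Y / 2))) (at Y)"
    by (rule DERIV_cong[OF DERIV_chain2[where f=slope and g="\<lambda>s. b * s / 2", OF slope_deriv(1)[OF *]]])
       (auto intro!: derivative_eq_intros simp: field_simps)
  show "0 < flux' (slope (b * Y / 2))"
    by (rule slope_deriv(2)[OF *])
qed

lemma profile_deriv:
  assumes "Y \<in> {0..R}"
  shows "(profile has_real_derivative slope (b * Y / 2)) (at Y within {0..R})"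
  unfolding profile_def
  using integral_has_real_derivative'[OF load_slope_continuous assms]
  by (auto intro!: derivative_eq_intros)

lemma deriv_on_profile:
  assumes "Y \<in> {0..R}"
  shows "deriv_on {0..R} profile Y = slope (b * Y / 2)"
  using at_within_Icc_minus_point(2)[OF R assms, of "Y + 1"] profile_deriv[OF assms]
  by (intro deriv_on_eqI) auto

lemma profile_C1: "Ck_on 1 {0..R} profile"
proof -
  have "continuous_on {0..R} (deriv_on {0..R} profile)"
    using load_slope_continuous by (rule continuous_on_eq) (simp add: deriv_on_profile)
  moreover have "profile differentiable at Y within {0..R}" if "Y \<in> {0..R}" for Y
    using profile_deriv[OF that] real_differentiable_def by blast
  ultimately show ?thesis by simp
qed

text \<open>The set \<open>S\<close> is arbitrary so that the same argument serves the open interval of classical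
  solutions and the punctured closed interval of generalized ones.\<close>

lemma profile_C2:
  assumes "S \<subseteq> {0..R} - {Y_crit}" "\<And>x. x \<in> S \<Longrightarrow> at x within S \<noteq> bot"
  shows "Ck_on 2 S profile"
    and "\<And>Y. Y \<in> S \<Longrightarrow> deriv_on S (deriv_on S profile) Y = b / 2 / flux' (slope (b * Y / 2))"
proof -
  have 1: "(profile has_real_derivative slope (b * Y / 2)) (at Y within S)" if "Y \<in> S" for Y
    using that assms(1) by (intro DERIV_subset[OF profile_deriv]) auto
  have 2: "((\<lambda>s. slope (b * s / 2)) has_real_derivative b / 2 / flux' (slope (b * Y / 2)))
             (at Y within S)" if "Y \<in> S" for Y
    using that assms(1)
    by (intro has_field_derivative_at_within[OF load_slope_deriv(1)]) auto
  have 3: "continuous_on S (\<lambda>Y. b / 2 / flux' (slope (b * Y / 2)))"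
    using load_slope_deriv(2) assms(1)
    by (intro continuous_intros continuous_on_compose2[OF flux'_continuous[of UNIV]]
        load_slope_continuous) (auto, force)
  show "Ck_on 2 S profile"
    and "\<And>Y. Y \<in> S \<Longrightarrow> deriv_on S (deriv_on S profile) Y = b / 2 / flux' (slope (b * Y / 2))"
    by (rule Ck_on_2I[OF assms(2) 1 2 3]; assumption)+
qed

text \<open>Since \<open>flux (slope (b y / 2)) = b y / 2\<close>, the expression under the outer derivative is just
  \<open>b y\<^sup>2 / 2\<close>; in particular the equation also holds at \<open>Y_crit\<close>, where the second derivative of the
  profile does not exist.\<close>

lemma profile_equation:
  assumes "Y \<in> {0<..<R}"
  shows "equation_at R b c Cu \<alpha> n profile Y"
proof -
  have "((\<lambda>y. visc \<bar>deriv_on {0..R} profile y\<bar> * y * deriv_on {0..R} profile y)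
          has_real_derivative b * Y) (at Y)"
  proof (rule has_field_derivative_transform_within_open)
    show "((\<lambda>y. b * y / 2 * y) has_real_derivative b * Y) (at Y)"
      by (auto intro!: derivative_eq_intros)
    fix y assume "y \<in> {0<..<R}"
    then have "deriv_on {0..R} profile y = slope (b * y / 2)"
      by (simp add: deriv_on_profile)
    then show "b * y / 2 * y = visc \<bar>deriv_on {0..R} profile y\<bar> * y * deriv_on {0..R} profile y"
      using flux_slope[of "b * y / 2"] unfolding flux_def by (metis mult.commute mult.left_commute)
  qed (use assms in auto)
  with assms show ?thesis
    unfolding equation_at_def by (intro exI[of _ "b * Y"]) simp
qed

lemma slope_0 [simp]: "slope 0 = 0"
  using slope_flux[of 0] by simp

lemma profile_boundary: "deriv_on {0..R} profile 0 = 0" "profile R = 0"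
  using R by (simp_all add: deriv_on_profile profile_def)

section \<open>Solution formula and uniqueness\<close>

lemma profile_solution_formula: "solution_formula R b c Cu \<alpha> n profile"
  unfolding solution_formula_def
proof (intro ballI conjI)
  fix Y assume Y: "Y \<in> {0..R}"
  have eq: "F_inv c Cu \<alpha> n (b * s / 2) = slope (b * s / 2)" if "s \<in> {Y..R}" for s
    using that Y b by (intro F_inv_eq_slope) auto
  have "(\<lambda>s. slope (b * s / 2)) integrable_on {Y..R}"
    by (intro integrable_continuous_real load_slope_continuous)
  then show "(\<lambda>s. F_inv c Cu \<alpha> n (b * s / 2)) integrable_on {Y..R}"
    by (rule integrable_eq) (simp add: eq)
  show "profile Y = - integral {Y..R} (\<lambda>s. F_inv c Cu \<alpha> n (b * s / 2))"
    unfolding profile_def using eq by (metis (mono_tags, lifting) integral_cong)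
  show "0 \<le> deriv_on {0..R} profile Y"
    using Y b by (simp add: deriv_on_profile slope_nonneg)
  have "F_inv c Cu \<alpha> n (b * R / 2) = slope (b * R / 2)"
    using R b by (intro F_inv_eq_slope) auto
  then show "deriv_on {0..R} profile Y \<le> F_inv c Cu \<alpha> n (b * R / 2)"
    using Y b by (auto simp: deriv_on_profile intro!: slope_mono)
qed

text \<open>The first integral of the equation. The finite set \<open>N\<close> of exceptional points covers classical
  solutions (\<open>N\<close> empty) and generalized ones together: continuity of the slope of \<open>V\<close> carries
  the constant of integration across \<open>N\<close>, and the factor \<open>Y\<close> makes this constant \<open>0\<close>.\<close>

lemma flux_of_solution:
  assumes C1: "Ck_on 1 {0..R} V" and "finite N"
    and eqn: "\<And>Y. Y \<in> {0<..<R} - N \<Longrightarrow> equation_at R b c Cu \<alpha> n V Y"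
    and V'0: "deriv_on {0..R} V 0 = 0" and Y: "Y \<in> {0..R}"
  shows "flux (deriv_on {0..R} V Y) = b * Y / 2"
proof -
  define v where "v = deriv_on {0..R} V"
  define w where "w = (\<lambda>y. visc \<bar>v y\<bar> * y * v y - b * y\<^sup>2 / 2)"
  have v: "continuous_on {0..R} v"
    using Ck_on_1_continuous[OF C1] by (simp add: v_def)
  have "w Y = 0"
  proof (rule has_derivative_zero_unique_strong_interval[where f=w and x=Y and y=0 and k="insert 0 (insert R N)" and a=0 and b=R])
    show "continuous_on {0..R} w"
      unfolding w_def
      by (intro continuous_intros v continuous_on_compose2[OF visc_continuous[of UNIV] v]) auto
    fix y assume "y \<in> {0..R} - insert 0 (insert R N)"
    then have y: "y \<in> {0<..<R} - N" by auto
    then obtain D where D: "((\<lambda>y. visc \<bar>v y\<bar> * y * v y) has_real_derivative D) (at y)" "1 / y * D = b"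
      using eqn[OF y] by (auto simp: equation_at_def v_def)
    then have "D = b * y"
      using y by (auto simp: field_simps)
    moreover have "((\<lambda>y. b * y\<^sup>2 / 2) has_real_derivative b * y) (at y)"
      by (auto intro!: derivative_eq_intros)
    ultimately have "(w has_real_derivative 0) (at y)"
      unfolding w_def using DERIV_diff[OF D(1)] by fastforce
    then have "(w has_real_derivative 0) (at y within {0..R})"
      by (rule has_field_derivative_at_within)
    then show "(w has_derivative (\<lambda>h. 0)) (at y within {0..R})"
      by (simp add: has_field_derivative_def lambda_zero)
  qed (use assms in \<open>auto simp: w_def\<close>)
  \<comment> \<open>at \<open>Y = 0\<close> the factor cannot be cancelled, and the boundary condition on the slope takes over\<close>
  then have "Y * (flux (v Y) - b * Y / 2) = 0"
    by (simp add: w_def flux_def power2_eq_square algebra_simps)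
  then show ?thesis
    using V'0 unfolding v_def by auto
qed

text \<open>The first integral prescribes the derivative of \<open>V\<close> everywhere on \<open>[0,R]\<close>, and the boundary
  condition at \<open>R\<close> fixes the remaining constant.\<close>

lemma solution_unique:
  assumes C1: "Ck_on 1 {0..R} V" and "finite N"
    and "\<And>Y. Y \<in> {0<..<R} - N \<Longrightarrow> equation_at R b c Cu \<alpha> n V Y"
    and "deriv_on {0..R} V 0 = 0" and VR: "V R = 0" and Y: "Y \<in> {0..R}"
  shows "V Y = profile Y"
proof -
  have "deriv_on {0..R} V y = slope (b * y / 2)" if "y \<in> {0..R}" for y
    using flux_of_solution[OF assms(1-4) that] by (metis slope_flux)
  then have "(V has_real_derivative slope (b * y / 2)) (at y within {Y..R})" if "y \<in> {Y..R}" for y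
    using Ck_on_1D[OF C1, of y] that Y by (auto intro: DERIV_subset)
  then have "((\<lambda>s. slope (b * s / 2)) has_integral V R - V Y) {Y..R}"
    using Y by (intro fundamental_theorem_of_calculus)
      (auto simp: has_real_derivative_iff_has_vector_derivative[symmetric])
  then show ?thesis
    using VR by (simp add: profile_def integral_unique)
qed

section \<open>The two regimes\<close>

text \<open>Below the threshold \<open>Y_crit\<close> is not in the open interval; in the case of equality it is the
  end point \<open>R\<close>, where a classical solution need not be twice differentiable.\<close>

lemma classical_existence_uniqueness:
  assumes "flux zeta_crit \<ge> b * R / 2"
  shows "classical_solution R b c Cu \<alpha> n profile"
    and "classical_solution R b c Cu \<alpha> n V \<Longrightarrow> Y \<in> {0..R} \<Longrightarrow> V Y = profile Y"
proof -
  have "R \<le> Y_crit"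
    using assms b by (simp add: Y_crit_def field_simps)
  then have "Ck_on 2 {0<..<R} profile"
    by (intro profile_C2) (auto simp: at_within_open[OF _ open_greaterThanLessThan])
  then show "classical_solution R b c Cu \<alpha> n profile"
    using profile_C1 profile_equation profile_boundary by (simp add: classical_solution_def)
  show "V Y = profile Y" if "classical_solution R b c Cu \<alpha> n V" "Y \<in> {0..R}"
    using that by (intro solution_unique[where N="{}"]) (auto simp: classical_solution_def)
qed

lemma generalized_existence_uniqueness:
  shows "generalized_solution R b c Cu \<alpha> n Y_crit profile"
    and "generalized_solution R b c Cu \<alpha> n Y_crit V \<Longrightarrow> Y \<in> {0..R} \<Longrightarrow> V Y = profile Y"
proof -
  have "Ck_on 2 ({0..R} - {Y_crit}) profile"
    using at_within_Icc_minus_point[OF R] by (intro profile_C2) auto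
  then show "generalized_solution R b c Cu \<alpha> n Y_crit profile"
    using profile_C1 profile_equation profile_boundary by (simp add: generalized_solution_def)
  show "V Y = profile Y" if "generalized_solution R b c Cu \<alpha> n Y_crit V" "Y \<in> {0..R}"
    using that by (intro solution_unique[where N="{Y_crit}"]) (auto simp: generalized_solution_def)
qed

text \<open>At \<open>Y_crit\<close> the slope is \<open>zeta_crit\<close>, where the derivative of the flux vanishes; on either side
  that derivative is positive, so its reciprocal tends to plus infinity.\<close>

lemma second_derivative_blow_up:
  assumes "Y_crit \<in> {0<..<R}"
  shows "filterlim (deriv_on ({0..R} - {Y_crit}) (deriv_on ({0..R} - {Y_crit}) profile)) at_top (at Y_crit)"
proof -
  have "eventually (\<lambda>Y. Y \<in> {0<..<R}) (at Y_crit)"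
    using assms by (intro eventually_at_in_open') auto
  then have near: "eventually (\<lambda>Y. Y \<in> {0..R} - {Y_crit}) (at Y_crit)"
    using eventually_neq_at_within[of Y_crit Y_crit UNIV] by eventually_elim auto
  have "isCont flux' (slope (b * Y_crit / 2))"
    using flux'_continuous[of UNIV] by (simp add: continuous_on_eq_continuous_at)
  moreover have "isCont (\<lambda>s. slope (b * s / 2)) Y_crit"
    using load_slope_continuous[of UNIV] by (simp add: continuous_on_eq_continuous_at)
  ultimately have "isCont (\<lambda>s. flux' (slope (b * s / 2))) Y_crit"
    by (rule isCont_o2[rotated])
  moreover have "flux' (slope (b * Y_crit / 2)) = 0"
    using b zeta_crit_pos by (simp add: Y_crit_def flux'_zero_iff)
  ultimately have "((\<lambda>s. flux' (slope (b * s / 2)) / (b / 2)) \<longlongrightarrow> 0) (at Y_crit)"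
    by (intro tendsto_divide_zero) (simp add: isCont_def)
  moreover have "eventually (\<lambda>s. 0 < flux' (slope (b * s / 2)) / (b / 2)) (at Y_crit)"
    using near by eventually_elim (use load_slope_deriv(2) b in auto)
  ultimately have "filterlim (\<lambda>s. inverse (flux' (slope (b * s / 2)) / (b / 2))) at_top (at Y_crit)"
    by (rule filterlim_inverse_at_top)
  moreover have "eventually (\<lambda>s. inverse (flux' (slope (b * s / 2)) / (b / 2)) =
      deriv_on ({0..R} - {Y_crit}) (deriv_on ({0..R} - {Y_crit}) profile) s) (at Y_crit)"
    using near
  proof eventually_elim
    case (elim s)
    have "deriv_on ({0..R} - {Y_crit}) (deriv_on ({0..R} - {Y_crit}) profile) s
        = b / 2 / flux' (slope (b * s / 2))"
      using elim at_within_Icc_minus_point[OF R] by (intro profile_C2(2)) auto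
    then show ?case by simp
  qed
  ultimately show ?thesis
    by (rule filterlim_cong[OF refl refl, THEN iffD1, rotated])
qed

end

section \<open>Existence, uniqueness and blow-up\<close>

theorem theorem2p3:
  fixes R Cu b \<alpha> n c :: real
  assumes "R > 0" and "Cu > 0" and "b > 0" and "\<alpha> > 0" and "n < 0" and "0 < c" and "c < 1"
    and "(1 - (\<alpha> + 1) / n) powr ((n - 1 - \<alpha>) / \<alpha>) = (1 - c) / (\<alpha> * c)"
  shows
    "bij_betw (F c Cu \<alpha> n) {0..} {0..} \<and>
     (let K = (1 - c + c * (1 - (\<alpha> + 1) / n) powr ((n - 1) / \<alpha>))
                * inverse Cu * (- (\<alpha> + 1) / n) powr (1 / \<alpha>);
          Y\<^sub>0 = 2 / b * K
      in
       (K \<ge> b * R / 2 \<longrightarrow>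
         (\<exists>U. classical_solution R b c Cu \<alpha> n U \<and>
              (\<forall>V. classical_solution R b c Cu \<alpha> n V \<longrightarrow> (\<forall>Y\<in>{0..R}. V Y = U Y)) \<and>
              solution_formula R b c Cu \<alpha> n U)) \<and>
       (K < b * R / 2 \<longrightarrow>
         Y\<^sub>0 \<in> {0<..<R} \<and>
         (\<exists>U. generalized_solution R b c Cu \<alpha> n Y\<^sub>0 U \<and>
              (\<forall>V. generalized_solution R b c Cu \<alpha> n Y\<^sub>0 V \<longrightarrow> (\<forall>Y\<in>{0..R}. V Y = U Y)) \<and>
              solution_formula R b c Cu \<alpha> n U \<and>
              filterlim (deriv_on ({0..R} - {Y\<^sub>0}) (deriv_on ({0..R} - {Y\<^sub>0}) U)) at_top (at Y\<^sub>0))))"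
proof -
  interpret carreau_pipe c Cu \<alpha> n R b
    using assms by unfold_locales auto
  define K where "K = (1 - c + c * (1 - (\<alpha> + 1) / n) powr ((n - 1) / \<alpha>))
                * inverse Cu * (- (\<alpha> + 1) / n) powr (1 / \<alpha>)"
  have "flux zeta_crit = (1 - c + c * (1 + scaled_shear zeta_crit) powr ((n - 1) / \<alpha>)) * zeta_crit"
    using zeta_crit_pos by (simp add: flux_def viscosity_def scaled_shear_def)
  also have "1 + scaled_shear zeta_crit = 1 - (\<alpha> + 1) / n"
    by (simp only: scaled_shear_zeta_crit one_plus_x_crit)
  finally have K: "K = flux zeta_crit"
    by (simp only: K_def zeta_crit_def x_crit_def mult.assoc)
  then have Y0: "2 / b * K = Y_crit"
    by (simp add: Y_crit_def)
  have range: "Y_crit \<in> {0<..<R}" if "K < b * R / 2"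
  proof -
    have "0 < K"
      using strict_monoD[OF flux_strict_mono zeta_crit_pos] by (simp add: K)
    with that assms(3) show ?thesis
      by (simp add: Y0[symmetric] field_simps)
  qed
  show ?thesis
    unfolding K_def[symmetric] Let_def Y0
    using F_bij range classical_existence_uniqueness generalized_existence_uniqueness
      profile_solution_formula second_derivative_blow_up
    unfolding K by blast
qed

end
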